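(* Let $f:[0,1]\to\mathbb{R}^{+}=(0,\infty)$ be log-convex, let $N\in\mathbb{N}$ (with $N\ge 1$) and $0\le t\le 1$. Then $$K\left(\sqrt[2^N]{\frac{f(1)}{f(0)}},2\right)^{\beta_N(t)}f(t)+S_{N}(t;f(1),f(0))\leq t f(1)+(1-t)f(0).$$
   Context: A function $f:I\to(0,\infty)$ on an interval $I$ is log-convex if $f(\lambda t_1+(1-\lambda)t_2)\leq f(t_1)^{\lambda}f(t_2)^{1-\lambda}$ for all $t_1,t_2\in I$ and $0\leq \lambda\leq 1$. $[x]$ denotes the greatest integer $\le x$. $K(t,2)=\frac{(t+1)^2}{4t}$ for $t>0$ (Kantorovich constant). $\alpha_N(\nu)=1+[2^{N}\nu]-2^{N}\nu$ and $\beta_N(\nu)=\min\{\alpha_N(\nu),1-\alpha_N(\nu)\}$. For $\nu\in[0,1]$ and $j\geq 1$ put $k_j(\nu)=[2^{j-1}\nu]$, $r_j(\nu)=[2^{j}\nu]$ and $s_j(\nu)=(-1)^{r_j(\nu)}2^{j-1}\nu+(-1)^{r_j(\nu)+1}\left[\frac{r_j(\nu)+1}{2}\right]$. For $a,b>0$, $\nu\in[0,1]$ and $N\ge 1$ define $$S_N(\nu;a,b)=\sum_{j=1}^{N}s_j(\nu)\left(\sqrt[2^j]{b^{2^{j-1}-k_j(\nu)}a^{k_j(\nu)}}-\sqrt[2^{j}]{a^{k_j(\nu)+1}b^{2^{j-1}-k_j(\nu)-1}}\right)^2 .$$ *)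

theory Defs
  imports "HOL-Analysis.Analysis"
begin

definition log_convex_on :: "real set \<Rightarrow> (real \<Rightarrow> real) \<Rightarrow> bool" where
  "log_convex_on I f \<longleftrightarrow> is_interval I \<and> (\<forall>t\<in>I. 0 < f t) \<and>
     (\<forall>t\<^sub>1\<in>I. \<forall>t\<^sub>2\<in>I. \<forall>c. 0 \<le> c \<and> c \<le> 1 \<longrightarrow>
        f (c * t\<^sub>1 + (1 - c) * t\<^sub>2) \<le> f t\<^sub>1 powr c * f t\<^sub>2 powr (1 - c))"

text \<open>The Kantorovich constant \<open>K(t,2)\<close>, with the second argument fixed to 2.\<close>

definition K2 :: "real \<Rightarrow> real" where
  "K2 t = (t + 1)^2 / (4 * t)"

definition alpha :: "nat \<Rightarrow> real \<Rightarrow> real" where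
  "alpha N \<nu> = 1 + of_int \<lfloor>2^N * \<nu>\<rfloor> - 2^N * \<nu>"

definition beta :: "nat \<Rightarrow> real \<Rightarrow> real" where
  "beta N \<nu> = min (alpha N \<nu>) (1 - alpha N \<nu>)"

definition k_exp :: "nat \<Rightarrow> real \<Rightarrow> int" where
  "k_exp j \<nu> = \<lfloor>2^(j - 1) * \<nu>\<rfloor>"

definition r_floor :: "nat \<Rightarrow> real \<Rightarrow> int" where
  "r_floor j \<nu> = \<lfloor>2^j * \<nu>\<rfloor>"

definition s_coeff :: "nat \<Rightarrow> real \<Rightarrow> real" where
  "s_coeff j \<nu> = (-1) powi (r_floor j \<nu>) * 2^(j - 1) * \<nu>
          + (-1) powi (r_floor j \<nu> + 1) * of_int \<lfloor>(of_int (r_floor j \<nu>) + 1) / (2::real)\<rfloor>"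

text \<open>The exponents are integers, not naturals: for \<open>\<nu> = 1\<close> one has \<open>k_exp j \<nu> = 2^(j - 1)\<close>,
  so that the last exponent of \<open>b\<close> is \<open>-1\<close>.\<close>

definition S_sum :: "nat \<Rightarrow> real \<Rightarrow> real \<Rightarrow> real \<Rightarrow> real" where
  "S_sum N \<nu> a b = (\<Sum>j=1..N. s_coeff j \<nu> *
     (root (2^j) (b powi (2^(j - 1) - k_exp j \<nu>) * a powi (k_exp j \<nu>))
      - root (2^j) (a powi (k_exp j \<nu> + 1) * b powi (2^(j - 1) - k_exp j \<nu> - 1)))^2)"

end

theory Submission
  imports Defs
begin

text \<open>Put \<open>a = f 1\<close> and \<open>b = f 0\<close>. Log-convexity gives \<open>f t \<le> g t\<close> for the weighted geometric mean
  \<open>g t = a\<^sup>t b\<^sup>1\<^sup>-\<^sup>t\<close>. The sum \<open>S\<^sub>N\<close> telescopes: its \<open>j\<close>-th term is the difference of the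
  piecewise linear interpolants of \<open>g\<close> at the dyadic points of levels \<open>j - 1\<close> and \<open>j\<close>. Hence
  \<open>t a + (1 - t) b - S\<^sub>N\<close> is the interpolant of level \<open>N\<close>, and on a single dyadic interval the
  Kantorovich refinement of Young's inequality compares this interpolant with \<open>g\<close>.\<close>

definition weighted_geo_mean :: "real \<Rightarrow> real \<Rightarrow> real \<Rightarrow> real" where
  "weighted_geo_mean a b u = a powr u * b powr (1 - u)"

text \<open>The right node may lie beyond the interval [0,1]: for \<open>t = 1\<close> it is 1 +
  1/2^n, where it gets weight \<open>frac (2^n * t) = 0\<close>.\<close>

definition dyadic_interpolant :: "(real \<Rightarrow> real) \<Rightarrow> nat \<Rightarrow> real \<Rightarrow> real" where
  "dyadic_interpolant g n t =
     (1 - frac (2^n * t)) * g (of_int \<lfloor>2^n * t\<rfloor> / 2^n)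
     + frac (2^n * t) * g ((of_int \<lfloor>2^n * t\<rfloor> + 1) / 2^n)"

section \<open>Young's inequality with the Kantorovich constant\<close>

lemma K2_pos: "x > 0 \<Longrightarrow> K2 x > 0"
  by (simp add: K2_def add_pos_pos)

lemma K2_inverse: "x > 0 \<Longrightarrow> K2 (inverse x) = K2 x"
  by (simp add: K2_def field_simps power2_eq_square)

text \<open>With the arithmetic mean m of x and y one has K2(y/x) * xy = m^2, so the left side
  equals x^(1-2v) * m^(2v). The plain Young inequality with weights 1-2v and 2v then gives the
  claim; v \<le> 1/2 keeps the first weight nonnegative.\<close>

lemma young_kantorovich_half:
  fixes x y v :: real
  assumes "x > 0" "y > 0" "0 \<le> v" "v \<le> 1/2"
  shows "K2 (y / x) powr v * (x powr (1 - v) * y powr v) \<le> (1 - v) * x + v * y"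
proof -
  define m where "m = (x + y) / 2"
  have m: "m > 0" using assms by (simp add: m_def)
  have "K2 (y / x) * (x * y) = m powr 2"
    using assms m by (simp add: K2_def m_def field_simps power2_eq_square)
  then have "(K2 (y / x) * (x * y)) powr v = m powr (2 * v)"
    by (simp add: powr_powr)
  then have "K2 (y / x) powr v * (x powr v * y powr v) = m powr (2 * v)"
    using assms K2_pos[of "y / x"] by (simp add: powr_mult)
  moreover have "x powr (1 - v) = x powr (1 - 2 * v) * x powr v"
    by (simp flip: powr_add)
  ultimately have "K2 (y / x) powr v * (x powr (1 - v) * y powr v)
      = x powr (1 - 2 * v) * m powr (2 * v)"
    by (simp add: mult_ac)
  also have "\<dots> \<le> (1 - 2 * v) * x + 2 * v * m"
    using Youngs_inequality_0[of "1 - 2 * v" "2 * v" x m] assms m by simp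
  also have "\<dots> = (1 - v) * x + v * y"
    by (simp add: m_def field_simps)
  finally show ?thesis .
qed

text \<open>For v > 1/2, exchange x with y and v with 1-v; \<open>K2\<close> is invariant under
  inversion of its argument.\<close>

lemma young_kantorovich:
  fixes x y v :: real
  assumes "x > 0" "y > 0" "0 \<le> v" "v \<le> 1"
  shows "K2 (y / x) powr (min v (1 - v)) * (x powr (1 - v) * y powr v) \<le> (1 - v) * x + v * y"
proof (cases "v \<le> 1/2")
  case True
  then show ?thesis
    using young_kantorovich_half[of x y v] assms by (simp add: min_def)
next
  case False
  moreover have "K2 (x / y) = K2 (y / x)"
    using K2_inverse[of "y / x"] assms by simp
  ultimately show ?thesis
    using young_kantorovich_half[of y x "1 - v"] assms by (simp add: min_def mult_ac add_ac)
qed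

section \<open>Weighted geometric means\<close>

lemma weighted_geo_mean_pos: "a > 0 \<Longrightarrow> b > 0 \<Longrightarrow> weighted_geo_mean a b u > 0"
  by (simp add: weighted_geo_mean_def)

text \<open>The logarithm of \<open>weighted_geo_mean a b u\<close> is affine in
  \<open>u\<close>.\<close>

lemma weighted_geo_mean_convex_comb:
  assumes "a > 0" "b > 0"
  shows "weighted_geo_mean a b u powr (1 - v) * weighted_geo_mean a b w powr v
    = weighted_geo_mean a b ((1 - v) * u + v * w)"
proof -
  have "weighted_geo_mean a b u powr (1 - v) * weighted_geo_mean a b w powr v
    = (a powr (u * (1 - v)) * a powr (w * v)) * (b powr ((1 - u) * (1 - v)) * b powr ((1 - w) * v))"
    using assms by (simp add: weighted_geo_mean_def powr_mult powr_powr mult_ac)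
  also have "\<dots> = a powr (u * (1 - v) + w * v) * b powr ((1 - u) * (1 - v) + (1 - w) * v)"
    by (simp only: powr_add)
  also have "\<dots> = weighted_geo_mean a b ((1 - v) * u + v * w)"
    unfolding weighted_geo_mean_def
    by (intro arg_cong2[where f = "(*)"] arg_cong2[where f = "(powr)"]) (auto simp: algebra_simps)
  finally show ?thesis .
qed

lemma sqrt_weighted_geo_mean:
  "sqrt (weighted_geo_mean a b u) = a powr (u / 2) * b powr ((1 - u) / 2)" if "a > 0" "b > 0"
  using that
  by (simp add: weighted_geo_mean_def real_sqrt_mult powr_half_sqrt[symmetric] powr_powr)

lemma weighted_geo_mean_midpoint:
  assumes "a > 0" "b > 0"
  shows "weighted_geo_mean a b ((u + w) / 2)
    = sqrt (weighted_geo_mean a b u) * sqrt (weighted_geo_mean a b w)"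
  using weighted_geo_mean_convex_comb[OF assms, of u "1/2" w] weighted_geo_mean_pos[OF assms]
  by (simp add: powr_half_sqrt less_imp_le add_divide_distrib)

lemma weighted_geo_mean_ratio:
  assumes "a > 0" "b > 0"
  shows "weighted_geo_mean a b w / weighted_geo_mean a b u = (a / b) powr (w - u)"
  using assms
  by (simp add: weighted_geo_mean_def powr_diff powr_divide field_simps)

lemma root_two_power_powi_mult:
  fixes x y :: real
  assumes "x > 0" "y > 0"
  shows "root (2^n) (x powi p * y powi q) = x powr (of_int p / 2^n) * y powr (of_int q / 2^n)"
  using assms
  by (simp add: root_powr_inverse powr_mult powr_powr flip: powr_real_of_int')

section \<open>Dyadic refinement and telescoping\<close>

lemma frac_floor_cases_double:
  fixes x :: real
  obtains "frac x < 1/2" "\<lfloor>2 * x\<rfloor> = 2 * \<lfloor>x\<rfloor>" "frac (2 * x) = 2 * frac x"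
  | "frac x \<ge> 1/2" "\<lfloor>2 * x\<rfloor> = 2 * \<lfloor>x\<rfloor> + 1" "frac (2 * x) = 2 * frac x - 1"
proof (cases "frac x < 1/2")
  case True
  then have "\<lfloor>2 * x\<rfloor> = 2 * \<lfloor>x\<rfloor>" by (simp add: frac_def) linarith
  with True that(1) show ?thesis by (simp add: frac_def)
next
  case False
  then have "\<lfloor>2 * x\<rfloor> = 2 * \<lfloor>x\<rfloor> + 1" by (simp add: frac_def) linarith
  with False that(2) show ?thesis by (simp add: frac_def)
qed

text \<open>Let x = 2^n t and k its floor. The parity of \<open>r_floor\<close> tells in which half
  of [k, k+1) the point x lies: for r = 2k the coefficient is x - k, for r = 2k+1 the signs flip and
  it is k + 1 - x. In both cases it is the distance from x to the nearest integer.\<close>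

lemma s_coeff_Suc:
  "s_coeff (Suc n) t = min (frac (2^n * t)) (1 - frac (2^n * t))"
proof -
  define x where "x = 2^n * t"
  have s: "s_coeff (Suc n) t = (-1) powi \<lfloor>2 * x\<rfloor> * x
      + (-1) powi (\<lfloor>2 * x\<rfloor> + 1) * of_int \<lfloor>(of_int \<lfloor>2 * x\<rfloor> + 1) / (2::real)\<rfloor>"
    by (simp add: s_coeff_def r_floor_def x_def mult_ac)
  show ?thesis
    unfolding x_def[symmetric]
  proof (cases x rule: frac_floor_cases_double)
    case 1
    have "\<lfloor>(of_int (2 * \<lfloor>x\<rfloor>) + 1) / (2::real)\<rfloor> = \<lfloor>x\<rfloor>"
      by (simp add: floor_eq_iff)
    with 1 show "s_coeff (Suc n) t = min (frac x) (1 - frac x)"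
      by (simp add: s power_int_add power_int_mult frac_def)
  next
    case 2
    have "\<lfloor>(of_int (2 * \<lfloor>x\<rfloor> + 1) + 1) / (2::real)\<rfloor> = \<lfloor>x\<rfloor> + 1"
      by (simp add: floor_eq_iff)
    with 2 show "s_coeff (Suc n) t = min (frac x) (1 - frac x)"
      by (simp add: s power_int_add power_int_mult frac_def)
  qed
qed

text \<open>Let A^2 and B^2 be the values of g at the ends of the dyadic interval. As g is
  geometric, its value at the midpoint is AB, which lies (A-B)^2 / 2 below the chord. Inserting this
  node lowers the interpolant by a tent of that height, and the unit tent is 2 * min(frac x, 1 -
  frac x).\<close>

lemma dyadic_interpolant_diff:
  assumes "a > 0" "b > 0"
  defines "g \<equiv> weighted_geo_mean a b"
  shows "dyadic_interpolant g n t - dyadic_interpolant g (Suc n) t =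
    s_coeff (Suc n) t *
      (sqrt (g (of_int \<lfloor>2^n * t\<rfloor> / 2^n)) - sqrt (g ((of_int \<lfloor>2^n * t\<rfloor> + 1) / 2^n)))\<^sup>2"
proof -
  define x where "x = 2^n * t"
  define k :: real where "k = of_int \<lfloor>x\<rfloor>"
  define A where "A = sqrt (g (k / 2^n))"
  define B where "B = sqrt (g ((k + 1) / 2^n))"
  have A: "g (k / 2^n) = A\<^sup>2" and B: "g ((k + 1) / 2^n) = B\<^sup>2"
    using weighted_geo_mean_pos[OF assms(1,2)] by (simp_all add: A_def B_def g_def less_imp_le)
  have "(k / 2^n + (k + 1) / 2^n) / 2 = (2 * k + 1) / 2 ^ Suc n"
    by (simp add: field_simps)
  then have mid: "g ((2 * k + 1) / 2 ^ Suc n) = A * B"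
    using weighted_geo_mean_midpoint[OF assms(1,2), of "k / 2^n" "(k + 1) / 2^n"]
    unfolding A_def B_def g_def by (simp only:)
  have fine: "(2 * k) / 2 ^ Suc n = k / 2^n" "(2 * k + 1 + 1) / 2 ^ Suc n = (k + 1) / 2^n"
    by (simp_all add: field_simps)
  have coarse: "dyadic_interpolant g n t = (1 - frac x) * A\<^sup>2 + frac x * B\<^sup>2"
    by (simp add: dyadic_interpolant_def A B flip: x_def k_def)
  have double: "2 ^ Suc n * t = 2 * x"
    by (simp add: x_def)
  have "dyadic_interpolant g n t - dyadic_interpolant g (Suc n) t
      = min (frac x) (1 - frac x) * (A - B)\<^sup>2"
  proof (cases x rule: frac_floor_cases_double)
    case 1
    then have "dyadic_interpolant g (Suc n) t = (1 - 2 * frac x) * A\<^sup>2 + 2 * frac x * (A * B)"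
      unfolding dyadic_interpolant_def double
      by (simp only: of_int_mult of_int_numeral k_def[symmetric] fine mid A)
    with 1 coarse show ?thesis
      by (simp add: min_def power2_eq_square algebra_simps)
  next
    case 2
    then have "dyadic_interpolant g (Suc n) t
        = (1 - (2 * frac x - 1)) * (A * B) + (2 * frac x - 1) * B\<^sup>2"
      unfolding dyadic_interpolant_def double
      by (simp only: of_int_mult of_int_add of_int_1 of_int_numeral k_def[symmetric] fine mid B)
    moreover from 2 have "min (frac x) (1 - frac x) = 1 - frac x"
      by simp
    ultimately show ?thesis
      by (simp add: coarse power2_eq_square algebra_simps)
  qed
  then show ?thesis
    by (simp add: s_coeff_Suc A_def B_def k_def x_def)
qed

text \<open>To telescope, the roots in the summand of index n+1 must be recognised as the square
  roots of the geometric mean at k/2^n and (k+1)/2^n, the ends of the level n interval containing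
  t.\<close>

lemma S_sum_eq_dyadic_interpolant:
  assumes "a > 0" "b > 0"
  shows "S_sum N t a b = dyadic_interpolant (weighted_geo_mean a b) 0 t
    - dyadic_interpolant (weighted_geo_mean a b) N t"
proof (induction N)
  case 0
  show ?case by (simp add: S_sum_def)
next
  case (Suc n)
  define k where "k = \<lfloor>2^n * t\<rfloor>"
  have sqrt_mean: "sqrt (weighted_geo_mean a b (u / 2^n))
      = a powr (u / 2 ^ Suc n) * b powr ((2^n - u) / 2 ^ Suc n)" for u :: real
  proof -
    have "u / 2^n / 2 = u / 2 ^ Suc n" "(1 - u / 2^n) / 2 = (2^n - u) / 2 ^ Suc n"
      by (simp_all add: field_simps)
    then show ?thesis
      by (simp only: sqrt_weighted_geo_mean[OF assms])
  qed
  have "root (2 ^ Suc n) (b powi (2^n - k) * a powi k)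
      = sqrt (weighted_geo_mean a b (of_int k / 2^n))"
    using assms by (simp add: sqrt_mean root_two_power_powi_mult mult.commute del: power_Suc)
  moreover have "root (2 ^ Suc n) (a powi (k + 1) * b powi (2^n - k - 1))
      = sqrt (weighted_geo_mean a b ((of_int k + 1) / 2^n))"
    using assms by (simp add: sqrt_mean root_two_power_powi_mult diff_diff_eq del: power_Suc)
  ultimately have "S_sum (Suc n) t a b = S_sum n t a b
      + (dyadic_interpolant (weighted_geo_mean a b) n t
         - dyadic_interpolant (weighted_geo_mean a b) (Suc n) t)"
    by (simp add: S_sum_def k_exp_def dyadic_interpolant_diff[OF assms] flip: k_def
             del: power_Suc)
  with Suc show ?case by simp
qed

lemma dyadic_interpolant_0:
  assumes "a > 0" "b > 0" "0 \<le> t" "t \<le> 1"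
  shows "dyadic_interpolant (weighted_geo_mean a b) 0 t = t * a + (1 - t) * b"
proof (cases "t = 1")
  \<comment> \<open>Here the floor of t is 1, so the interpolant belongs to [1,2] and takes its left
    value, which is a.\<close>
  case True
  then show ?thesis using assms by (simp add: dyadic_interpolant_def weighted_geo_mean_def)
next
  case False
  then have "\<lfloor>t\<rfloor> = 0" using assms by linarith
  then show ?thesis
    using assms by (simp add: dyadic_interpolant_def weighted_geo_mean_def frac_def)
qed

text \<open>Values at neighbouring nodes have the ratio (a/b)^(1/2^N) on every interval, which is
  why the argument of \<open>K2\<close> does not depend on t. Since t divides its interval in the
  proportion v : 1-v, the geometric mean of the end values with weights 1-v and v is the value at
  t.\<close>

lemma dyadic_interpolant_lower_bound:
  assumes "a > 0" "b > 0"
  shows "K2 (root (2^N) (a / b)) powr (beta N t) * weighted_geo_mean a b t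
    \<le> dyadic_interpolant (weighted_geo_mean a b) N t"
proof -
  define k :: real where "k = of_int \<lfloor>2^N * t\<rfloor>"
  define v where "v = frac (2^N * t)"
  define x where "x = weighted_geo_mean a b (k / 2^N)"
  define y where "y = weighted_geo_mean a b ((k + 1) / 2^N)"
  have "x > 0" "y > 0"
    using weighted_geo_mean_pos[OF assms] by (simp_all add: x_def y_def)
  have v: "0 \<le> v" "v \<le> 1"
    by (simp_all add: v_def less_imp_le frac_lt_1)
  have tv: "2^N * t = k + v"
    by (simp add: v_def k_def frac_def)
  have "(1 - v) * (k / 2^N) + v * ((k + 1) / 2^N) = (k + v) / 2^N"
    by (simp add: field_simps)
  also have "\<dots> = t"
    by (simp flip: tv)
  finally have mean: "x powr (1 - v) * y powr v = weighted_geo_mean a b t"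
    by (simp add: x_def y_def weighted_geo_mean_convex_comb[OF assms])
  have "y / x = (a / b) powr (1 / 2^N)"
    by (simp add: x_def y_def weighted_geo_mean_ratio[OF assms] flip: diff_divide_distrib)
  then have ratio: "y / x = root (2^N) (a / b)"
    using assms by (simp add: root_powr_inverse)
  \<comment> \<open>By definition \<open>alpha N t\<close> is 1 - v.\<close>
  have "beta N t = min v (1 - v)"
    by (simp add: beta_def alpha_def v_def frac_def min.commute)
  moreover have "dyadic_interpolant (weighted_geo_mean a b) N t = (1 - v) * x + v * y"
    by (simp add: dyadic_interpolant_def v_def x_def y_def k_def)
  ultimately show ?thesis
    using young_kantorovich[OF \<open>x > 0\<close> \<open>y > 0\<close> v] by (simp add: mean ratio)
qed

lemma log_convex_on_le_weighted_geo_mean: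
  assumes "log_convex_on {0..1} f" "0 \<le> t" "t \<le> 1"
  shows "f t \<le> weighted_geo_mean (f 1) (f 0) t"
proof -
  \<comment> \<open>Log-convexity is used only here, between the endpoints 1 and 0 with weight
    t.\<close>
  have "f (t * 1 + (1 - t) * 0) \<le> f 1 powr t * f 0 powr (1 - t)"
    using assms unfolding log_convex_on_def by (meson atLeastAtMost_iff order_refl zero_le_one)
  then show ?thesis by (simp add: weighted_geo_mean_def)
qed

theorem proposition3p1:
  fixes f :: "real \<Rightarrow> real" and N :: nat and t :: real
  assumes "log_convex_on {0..1} f"
    and "N \<ge> 1"
    and "0 \<le> t" and "t \<le> 1"
  shows "K2 (root (2^N) (f 1 / f 0)) powr (beta N t) * f t + S_sum N t (f 1) (f 0)
           \<le> t * f 1 + (1 - t) * f 0"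
proof -
  have pos: "f 1 > 0" "f 0 > 0"
    using assms(1) by (auto simp: log_convex_on_def)
  have "K2 (root (2^N) (f 1 / f 0)) powr (beta N t) * f t
      \<le> K2 (root (2^N) (f 1 / f 0)) powr (beta N t) * weighted_geo_mean (f 1) (f 0) t"
    using log_convex_on_le_weighted_geo_mean[OF assms(1,3,4)] by (rule mult_left_mono) simp
  also have "\<dots> \<le> dyadic_interpolant (weighted_geo_mean (f 1) (f 0)) N t"
    by (rule dyadic_interpolant_lower_bound[OF pos])
  finally show ?thesis
    by (simp add: S_sum_eq_dyadic_interpolant[OF pos] dyadic_interpolant_0[OF pos assms(3,4)])
qed

end
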